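(* Let $G$ be a finite simple graph with $n \geq 4$ vertices and fewer than $\frac{19n-28}{8}$ edges. Then $G$ has a forest cut, i.e. there is a set $M \subset V(G)$ such that $G - M$ is disconnected and the subgraph of $G$ induced on $M$ is a forest.
   Context: Graphs are finite, undirected, without loops or multiple edges. A vertex cut of $G$ is a subset $M \subset V(G)$ whose removal disconnects $G$. A forest cut is a vertex cut $M$ such that the induced subgraph $G[M]$ is a forest (acyclic). *)

theory Defs
  imports Complex_Main
begin

definition simple_graph :: "'a set \<Rightarrow> 'a set set \<Rightarrow> bool" where
  "simple_graph V E \<longleftrightarrow> finite V \<and> (\<forall>e\<in>E. e \<subseteq> V \<and> card e = 2)"

definition induced_edges :: "'a set set \<Rightarrow> 'a set \<Rightarrow> 'a set set" where
  "induced_edges E W = {e \<in> E. e \<subseteq> W}"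

(* The graph without vertices counts as connected, so deleting all vertices does not disconnect. *)
definition connected_graph :: "'a set \<Rightarrow> 'a set set \<Rightarrow> bool" where
  "connected_graph V E \<longleftrightarrow> (\<forall>u\<in>V. \<forall>v\<in>V. (\<lambda>x y. {x, y} \<in> E)\<^sup>*\<^sup>* u v)"

definition cycle :: "'a set set \<Rightarrow> 'a list \<Rightarrow> bool" where
  "cycle E xs \<longleftrightarrow> 3 \<le> length xs \<and> distinct xs \<and>
     (\<forall>i<length xs. {xs ! i, xs ! (Suc i mod length xs)} \<in> E)"

definition forest :: "'a set set \<Rightarrow> bool" where
  "forest E \<longleftrightarrow> \<not> (\<exists>xs. cycle E xs)"

(* If the graph is already disconnected, the empty set is a vertex cut. *)
definition vertex_cut :: "'a set \<Rightarrow> 'a set set \<Rightarrow> 'a set \<Rightarrow> bool" where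
  "vertex_cut V E M \<longleftrightarrow> M \<subseteq> V \<and> \<not> connected_graph (V - M) (induced_edges E (V - M))"

definition forest_cut :: "'a set \<Rightarrow> 'a set set \<Rightarrow> 'a set \<Rightarrow> bool" where
  "forest_cut V E M \<longleftrightarrow> vertex_cut V E M \<and> forest (induced_edges E M)"

end

theory Submission
  imports Defs
begin

text \<open>Take a counterexample with as few vertices as possible. The open neighbourhood of a small
  vertex set is a vertex cut, so it spans a cycle; and deleting \<open>k\<close> vertices while losing at least
  \<open>19 k / 8\<close> edges (some edges may be added to compensate) gives a smaller graph with a forest cut,
  which must not extend to the deleted vertices. Local arguments of these two kinds show: all
  degrees are at least 4; the neighbourhood of a degree-4 vertex \<open>v\<close> contains a unique triangle, whose
  vertices (the strong neighbours of \<open>v\<close>) have degree at least 5; and a vertex of degree 5 is a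
  strong neighbour of at most one vertex. Now give every vertex \<open>v\<close> the charge \<open>4 deg v - 19\<close> and let
  each degree-4 vertex, whose charge is \<open>-3\<close>, receive 1 from each of its three strong neighbours.
  No charge ends up negative, so there are at least \<open>19 n / 8\<close> edges.\<close>

section \<open>Cycles and forests\<close>

text \<open>Trades indices modulo the length for list operations, so that cycles can be split at a
  vertex.\<close>

lemma cycle_iff_successively:
  "cycle E xs \<longleftrightarrow> 3 \<le> length xs \<and> distinct xs \<and>
     successively (\<lambda>x y. {x, y} \<in> E) xs \<and> {last xs, hd xs} \<in> E"
proof (cases "3 \<le> length xs")
  case True
  let ?n = "length xs"
  have ne: "xs \<noteq> []" using True by auto
  have "(\<forall>i<?n. {xs ! i, xs ! (Suc i mod ?n)} \<in> E) \<longleftrightarrow>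
      (\<forall>i. Suc i < ?n \<longrightarrow> {xs ! i, xs ! Suc i} \<in> E) \<and> {xs ! (?n - 1), xs ! 0} \<in> E" (is "?L \<longleftrightarrow> ?R")
  proof
    assume L: ?L
    have "{xs ! i, xs ! Suc i} \<in> E" if "Suc i < ?n" for i
      using L[rule_format, of i] that by simp
    moreover have "{xs ! (?n - 1), xs ! 0} \<in> E"
    proof -
      have "Suc (?n - 1) = ?n" "?n - 1 < ?n" using True by linarith+
      then show ?thesis using L by (metis mod_self)
    qed
    ultimately show ?R by blast
  next
    assume R: ?R
    show ?L
    proof (intro allI impI)
      fix i assume i: "i < ?n"
      show "{xs ! i, xs ! (Suc i mod ?n)} \<in> E"
      proof (cases "Suc i < ?n")
        case True
        with R show ?thesis by simp
      next
        case False
        with i have "Suc i = ?n" "i = ?n - 1" by auto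
        then show ?thesis using R by (metis mod_self)
      qed
    qed
  qed
  then show ?thesis
    using True ne by (simp add: cycle_def successively_conv_nth last_conv_nth hd_conv_nth)
next
  case False
  then show ?thesis by (simp add: cycle_def)
qed

lemma cycle_edge_doubleton:
  assumes "cycle E xs" and "i < length xs"
  shows "card {xs ! i, xs ! (Suc i mod length xs)} = 2"
proof -
  let ?j = "Suc i mod length xs"
  have l: "3 \<le> length xs" "distinct xs" using assms by (auto simp: cycle_def)
  have "?j < length xs" using l by (intro mod_less_divisor) linarith
  moreover have "i \<noteq> ?j"
    using l assms(2) by (cases "Suc i < length xs") (auto simp: not_less le_Suc_eq)
  ultimately have "xs ! i \<noteq> xs ! ?j"
    using l assms(2) by (simp add: nth_eq_iff_index_eq)
  then show ?thesis by simp
qed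

text \<open>Consecutive vertices of a cycle differ, so singletons among the edges never contribute.
  This is what allows degenerate new edges in \<open>reduction\<close>.\<close>

lemma cycle_drop_loops:
  assumes "cycle E xs"
  shows "cycle {e \<in> E. card e = 2} xs"
  using assms cycle_edge_doubleton[OF assms] by (simp add: cycle_def)

lemma cycle_mono: "cycle E xs \<Longrightarrow> E \<subseteq> E' \<Longrightarrow> cycle E' xs"
  by (auto simp: cycle_def)

lemma forest_mono: "forest E' \<Longrightarrow> E \<subseteq> E' \<Longrightarrow> forest E"
  by (auto simp: forest_def dest: cycle_mono)

lemma cycle_induced_subset:
  assumes "cycle (induced_edges E M) xs"
  shows "set xs \<subseteq> M"
proof
  fix x assume "x \<in> set xs"
  then obtain i where "i < length xs" "x = xs ! i" by (auto simp: in_set_conv_nth)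
  then show "x \<in> M" using assms by (auto simp: cycle_def induced_edges_def)
qed

text \<open>Rotating the cycle to start at \<open>v\<close> leaves the path \<open>bs @ as\<close>;
  its ends differ because a cycle has length at least 3.\<close>

lemma cycle_remove_vertex:
  assumes "cycle E xs" and "v \<in> set xs"
  obtains ys where "v \<notin> set ys" and "distinct ys" and "2 \<le> length ys" and "set ys \<subseteq> set xs"
    and "hd ys \<noteq> last ys" and "{v, hd ys} \<in> E" and "{v, last ys} \<in> E"
    and "successively (\<lambda>x y. {x, y} \<in> E) ys"
proof -
  obtain as bs where xs: "xs = as @ v # bs" using assms(2) by (meson split_list)
  note c = assms(1)[unfolded cycle_iff_successively xs]
  let ?ys = "bs @ as"
  have len: "2 \<le> length ?ys" using c by simp
  have d: "distinct ?ys" "v \<notin> set ?ys" using c by auto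
  have succ: "successively (\<lambda>x y. {x, y} \<in> E) ?ys"
    using c by (auto simp: successively_append_iff successively_Cons split: if_splits)
  have h: "{v, hd ?ys} \<in> E"
    using c len by (cases bs; cases as) (auto simp: successively_append_iff successively_Cons insert_commute)
  have l: "{v, last ?ys} \<in> E"
    using c len by (cases bs; cases as rule: rev_cases)
      (auto simp: successively_append_iff successively_Cons insert_commute)
  have "hd ?ys \<noteq> last ?ys"
  proof -
    have "?ys ! 0 \<noteq> ?ys ! (length ?ys - 1)"
      using d len by (subst nth_eq_iff_index_eq) (auto simp del: length_append)
    then show ?thesis using len by (metis hd_conv_nth last_conv_nth list.size(3) not_numeral_le_zero)
  qed
  then show ?thesis using that[of ?ys] d len succ h l xs by auto
qed

lemma cycle_insert_vertex:
  assumes "cycle (induced_edges E (insert v M)) xs"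
  shows "cycle (induced_edges E M) xs \<or> v \<in> set xs"
proof (rule disjCI)
  assume "v \<notin> set xs"
  then have "xs ! i \<noteq> v" if "i < length xs" for i
    using that by auto
  moreover have "0 < length xs" using assms by (auto simp: cycle_def)
  ultimately show "cycle (induced_edges E M) xs"
    using assms unfolding cycle_def induced_edges_def
    by (auto simp: subset_iff)
qed

definition nbrs :: "'a set set \<Rightarrow> 'a \<Rightarrow> 'a set" where
  "nbrs E v = {u. {v, u} \<in> E}"

text \<open>A cycle through \<open>v\<close> would use two distinct neighbours of \<open>v\<close>
  in \<open>M\<close>.\<close>

lemma forest_insert_leaf:
  assumes "forest (induced_edges E M)" and "nbrs E v \<inter> M \<subseteq> {s}"
  shows "forest (induced_edges E (insert v M))"
  unfolding forest_def
proof
  assume "\<exists>xs. cycle (induced_edges E (insert v M)) xs"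
  then obtain xs where c: "cycle (induced_edges E (insert v M)) xs" by blast
  then have "v \<in> set xs" using cycle_insert_vertex assms(1) by (metis forest_def)
  from cycle_remove_vertex[OF c this] obtain ys where ys:
    "v \<notin> set ys" "2 \<le> length ys" "set ys \<subseteq> set xs" "hd ys \<noteq> last ys"
    "{v, hd ys} \<in> induced_edges E (insert v M)" "{v, last ys} \<in> induced_edges E (insert v M)" by metis
  have "hd ys \<in> set ys" "last ys \<in> set ys" using ys(2) by (auto intro!: hd_in_set last_in_set)
  then have "hd ys \<in> nbrs E v \<inter> M" "last ys \<in> nbrs E v \<inter> M"
    using ys by (auto simp: nbrs_def induced_edges_def)
  then show False using assms(2) ys(4) by blast
qed

text \<open>In a cycle through \<open>v\<close> the detour over \<open>v\<close> can be replaced by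
  the edge \<open>{s, t}\<close>, which gives a cycle of the graph with that edge added.\<close>

lemma forest_subdivide_edge:
  assumes "forest (induced_edges (insert {s, t} E) M)" and "nbrs E v \<inter> M \<subseteq> {s, t}" and "{s, t} \<notin> E"
  shows "forest (induced_edges E (insert v M))"
  unfolding forest_def
proof
  assume "\<exists>xs. cycle (induced_edges E (insert v M)) xs"
  then obtain xs where c: "cycle (induced_edges E (insert v M)) xs" by blast
  have "forest (induced_edges E M)"
    using assms(1) by (rule forest_mono) (auto simp: induced_edges_def)
  then have "v \<in> set xs" using cycle_insert_vertex c by (metis forest_def)
  from cycle_remove_vertex[OF c this] obtain ys where ys:
    "v \<notin> set ys" "distinct ys" "2 \<le> length ys" "set ys \<subseteq> set xs" "hd ys \<noteq> last ys"
    "{v, hd ys} \<in> induced_edges E (insert v M)" "{v, last ys} \<in> induced_edges E (insert v M)"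
    "successively (\<lambda>x y. {x, y} \<in> induced_edges E (insert v M)) ys" by metis
  have sub: "set ys \<subseteq> M" using ys(1,4) cycle_induced_subset[OF c] by auto
  have ends: "hd ys \<in> set ys" "last ys \<in> set ys" using ys(3) by (auto intro!: hd_in_set last_in_set)
  then have "hd ys \<in> nbrs E v \<inter> M" "last ys \<in> nbrs E v \<inter> M"
    using ys sub by (auto simp: nbrs_def induced_edges_def)
  then have st: "{last ys, hd ys} = {s, t}" using assms(2) ys(5) by blast
  have succ: "successively (\<lambda>x y. {x, y} \<in> induced_edges E M) ys"
    using ys(8) by (rule successively_mono) (use sub in \<open>auto simp: induced_edges_def\<close>)
  \<comment> \<open>A triangle on \<open>v\<close>, \<open>s\<close>, \<open>t\<close> would
    collapse to a single edge; it is excluded because \<open>{s, t}\<close> is not in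
    \<open>E\<close>.\<close>
  have "length ys \<noteq> 2"
  proof
    assume "length ys = 2"
    then obtain a b where "ys = [a, b]" by (auto simp: length_Suc_conv numeral_2_eq_2)
    then show False using succ st assms(3) by (auto simp: induced_edges_def insert_commute)
  qed
  then have "3 \<le> length ys" using ys(3) by linarith
  moreover have "successively (\<lambda>x y. {x, y} \<in> induced_edges (insert {s, t} E) M) ys"
    using succ by (rule successively_mono) (simp add: induced_edges_def)
  moreover have "{last ys, hd ys} \<subseteq> M" using sub ends by blast
  then have "{last ys, hd ys} \<in> induced_edges (insert {s, t} E) M"
    unfolding st by (simp add: induced_edges_def)
  ultimately have "cycle (induced_edges (insert {s, t} E) M) ys"
    using ys(2) by (simp add: cycle_iff_successively)
  then show False using assms(1) by (auto simp: forest_def)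
qed

lemma forest_no_triangle:
  assumes "forest (induced_edges E M)" and "{x, y, z} \<subseteq> M" and "distinct [x, y, z]"
    and "{x, y} \<in> E" and "{y, z} \<in> E" and "{x, z} \<in> E"
  shows False
proof -
  have "cycle (induced_edges E M) [x, y, z]"
    using assms by (simp add: cycle_iff_successively induced_edges_def insert_commute)
  then show False using assms(1) by (auto simp: forest_def)
qed

text \<open>At most 4 vertices leave room only for cycles of length 3 and 4, and a 4-cycle then
  exhausts \<open>M\<close>.\<close>

lemma not_forest_small:
  assumes "\<not> forest (induced_edges E M)" and "finite M" and "card M \<le> 4"
  shows "(\<exists>x y z. {x, y, z} \<subseteq> M \<and> distinct [x, y, z] \<and> {x, y} \<in> E \<and> {y, z} \<in> E \<and> {x, z} \<in> E) \<or>
    (\<exists>x y z t. M = {x, y, z, t} \<and> distinct [x, y, z, t] \<and>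
       {x, y} \<in> E \<and> {y, z} \<in> E \<and> {z, t} \<in> E \<and> {t, x} \<in> E)"
proof -
  obtain xs where c: "cycle (induced_edges E M) xs" using assms(1) by (auto simp: forest_def)
  have sub: "set xs \<subseteq> M" using cycle_induced_subset[OF c] .
  have d: "distinct xs" and l3: "3 \<le> length xs" using c by (auto simp: cycle_def)
  have "length xs \<le> card M" using sub assms(2) d by (metis card_mono distinct_card)
  then consider "length xs = 3" | "length xs = 4" "card M = 4" using assms(3) l3 by linarith
  then show ?thesis
  proof cases
    case 1
    then obtain x y z where "xs = [x, y, z]" by (auto simp: length_Suc_conv numeral_3_eq_3)
    then have xs: "xs = [x, y, z]" .
    have "{x, y, z} \<subseteq> M" "distinct [x, y, z]" using sub d xs by simp_all
    moreover have "{x, y} \<in> E" "{y, z} \<in> E" "{z, x} \<in> E"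
      using c xs by (simp_all add: cycle_iff_successively induced_edges_def)
    ultimately have "{x, y, z} \<subseteq> M \<and> distinct [x, y, z] \<and> {x, y} \<in> E \<and> {y, z} \<in> E \<and> {x, z} \<in> E"
      by (simp add: insert_commute)
    then show ?thesis by (intro disjI1 exI)
  next
    case 2
    then obtain x y z t where xs: "xs = [x, y, z, t]"
      by (auto simp: length_Suc_conv eval_nat_numeral)
    have "set xs = M" using sub assms(2) d 2 by (metis card_subset_eq distinct_card)
    then have "M = {x, y, z, t}" using xs by simp
    moreover have "distinct [x, y, z, t]" using d xs by simp
    moreover have "{x, y} \<in> E" "{y, z} \<in> E" "{z, t} \<in> E" "{t, x} \<in> E"
      using c xs by (simp_all add: cycle_iff_successively induced_edges_def)
    ultimately have "M = {x, y, z, t} \<and> distinct [x, y, z, t] \<and>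
        {x, y} \<in> E \<and> {y, z} \<in> E \<and> {z, t} \<in> E \<and> {t, x} \<in> E" by simp
    then show ?thesis by (intro disjI2 exI)
  qed
qed

text \<open>The first two edges of a cycle would both be \<open>f\<close>, although its first three
  vertices are distinct.\<close>

lemma forest_single_edge:
  assumes "\<And>a b. a \<in> M \<Longrightarrow> b \<in> M \<Longrightarrow> {a, b} \<in> E \<Longrightarrow> a \<noteq> b \<Longrightarrow> {a, b} = f"
  shows "forest (induced_edges E M)"
  unfolding forest_def
proof
  assume "\<exists>xs. cycle (induced_edges E M) xs"
  then obtain xs where c: "cycle (induced_edges E M) xs" by blast
  then have l: "3 \<le> length xs" "distinct xs" by (auto simp: cycle_def)
  have e: "{xs ! i, xs ! (Suc i mod length xs)} = f" if "i < length xs" for i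
  proof -
    have "{xs ! i, xs ! (Suc i mod length xs)} \<in> induced_edges E M"
      using c that by (simp add: cycle_def)
    moreover have "xs ! i \<noteq> xs ! (Suc i mod length xs)"
      using cycle_edge_doubleton[OF c that] by auto
    ultimately show ?thesis using assms by (simp add: induced_edges_def)
  qed
  have "0 < length xs" "1 < length xs" using l by linarith+
  moreover have "Suc 0 mod length xs = 1" "Suc 1 mod length xs = 2"
    using l by simp_all
  ultimately have "{xs ! 0, xs ! 1} = f" "{xs ! 1, xs ! 2} = f"
    using e[of 0] e[of 1] by auto
  then have "xs ! 0 = xs ! 1 \<or> xs ! 0 = xs ! 2" by (metis doubleton_eq_iff)
  moreover have "xs ! 0 \<noteq> xs ! 1"
    using nth_eq_iff_index_eq[OF l(2), of 0 1] l(1) by linarith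
  moreover have "xs ! 0 \<noteq> xs ! 2"
    using nth_eq_iff_index_eq[OF l(2), of 0 2] l(1) by linarith
  ultimately show False by blast
qed

section \<open>Forest separations\<close>

text \<open>The two sides of the separation are \<open>B\<close> and \<open>W - M - B\<close>. Edges of \<open>E\<close> that leave \<open>W\<close> are ignored.\<close>

definition forest_sep :: "'a set \<Rightarrow> 'a set set \<Rightarrow> 'a set \<Rightarrow> 'a set \<Rightarrow> bool" where
  "forest_sep W E M B \<longleftrightarrow> M \<subseteq> W \<and> B \<subseteq> W - M \<and> B \<noteq> {} \<and> W - M - B \<noteq> {} \<and>
     (\<forall>a\<in>W - M - B. \<forall>b\<in>B. {a, b} \<notin> E) \<and> forest (induced_edges E M)"

text \<open>Forwards, \<open>B\<close> is the component of one of two disconnected vertices;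
  backwards, \<open>B\<close> is closed under reachability.\<close>

lemma forest_cut_iff_sep: "forest_cut V E M \<longleftrightarrow> (\<exists>B. forest_sep V E M B)"
proof
  let ?r = "\<lambda>x y. {x, y} \<in> induced_edges E (V - M)"
  assume f: "forest_cut V E M"
  then obtain u v where uv: "u \<in> V - M" "v \<in> V - M" "\<not> ?r\<^sup>*\<^sup>* u v"
    unfolding forest_cut_def vertex_cut_def connected_graph_def by blast
  let ?B = "{w \<in> V - M. ?r\<^sup>*\<^sup>* u w}"
  have "{a, b} \<notin> E" if ab: "a \<in> V - M - ?B" "b \<in> ?B" for a b
  proof
    assume "{a, b} \<in> E"
    then have "?r b a" using ab by (auto simp: induced_edges_def insert_commute)
    then show False using ab by (auto intro: rtranclp.rtrancl_into_rtrancl)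
  qed
  moreover have "u \<in> ?B" "v \<in> V - M - ?B" using uv by auto
  ultimately have "forest_sep V E M ?B"
    using f unfolding forest_sep_def forest_cut_def vertex_cut_def by blast
  then show "\<exists>B. forest_sep V E M B" by blast
next
  let ?r = "\<lambda>x y. {x, y} \<in> induced_edges E (V - M)"
  assume "\<exists>B. forest_sep V E M B"
  then obtain B where B: "forest_sep V E M B" by blast
  then obtain a b where ab: "a \<in> V - M - B" "b \<in> B" unfolding forest_sep_def by blast
  have "w \<in> B" if "?r\<^sup>*\<^sup>* b w" for w
    using that
  proof induction
    case base
    show ?case using ab by simp
  next
    case (step y z)
    then have "{z, y} \<in> E" "z \<in> V - M" by (auto simp: induced_edges_def insert_commute)
    then show ?case using B step.IH unfolding forest_sep_def by blast
  qed
  then have "\<not> ?r\<^sup>*\<^sup>* b a" using ab by blast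
  then have "\<not> connected_graph (V - M) (induced_edges E (V - M))"
    using ab B unfolding connected_graph_def forest_sep_def by blast
  then show "forest_cut V E M"
    using B by (simp add: forest_cut_def vertex_cut_def forest_sep_def)
qed

lemma forest_sep_swap: "forest_sep W E M B \<Longrightarrow> forest_sep W E M (W - M - B)"
  unfolding forest_sep_def by (metis Diff_iff Diff_subset double_diff insert_commute subset_refl)

lemma forest_sep_mono:
  assumes "forest_sep W E' M B" and "E \<subseteq> E'"
  shows "forest_sep W E M B"
proof -
  have "induced_edges E M \<subseteq> induced_edges E' M" using assms(2) by (auto simp: induced_edges_def)
  then show ?thesis using assms forest_mono unfolding forest_sep_def by blast
qed

text \<open>A clique cannot meet both sides, so swapping them if necessary moves it off
  \<open>B\<close>.\<close>

lemma forest_sep_clique: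
  assumes "forest_sep W E M B" and "K \<subseteq> W"
    and "\<And>x y. x \<in> K \<Longrightarrow> y \<in> K \<Longrightarrow> x \<noteq> y \<Longrightarrow> {x, y} \<in> E"
  obtains B' where "forest_sep W E M B'" and "K \<inter> B' = {}"
proof (cases "K \<inter> B = {}")
  case True
  then show ?thesis using that assms(1) by blast
next
  case False
  then obtain b where b: "b \<in> K" "b \<in> B" by blast
  have "K \<inter> (W - M - B) = {}"
  proof (rule ccontr)
    assume "\<not> ?thesis"
    then obtain a where "a \<in> K" "a \<in> W - M - B" by blast
    then show False using assms(1,3) b unfolding forest_sep_def by blast
  qed
  then show ?thesis using that[OF forest_sep_swap[OF assms(1)]] by blast
qed

lemma forest_sep_extend_side:
  assumes "forest_sep W E M B" and "v \<notin> W" and "nbrs E v \<inter> B = {}"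
  shows "forest_sep (insert v W) E M B"
proof -
  have "M \<subseteq> W" "B \<subseteq> W" using assms(1) by (auto simp: forest_sep_def)
  then have "insert v W - M - B = insert v (W - M - B)" using assms(2) by blast
  moreover have "{v, b} \<notin> E" if "b \<in> B" for b using assms(3) that by (auto simp: nbrs_def)
  ultimately show ?thesis using assms(1,2) unfolding forest_sep_def by auto
qed

lemma forest_sep_extend_forest:
  assumes "forest_sep W E M B" and "v \<notin> W" and "forest (induced_edges E (insert v M))"
  shows "forest_sep (insert v W) E (insert v M) B"
proof -
  have "insert v W - insert v M - B = W - M - B" using assms(1,2) unfolding forest_sep_def by auto
  then show ?thesis using assms unfolding forest_sep_def by auto
qed

text \<open>The two ways to put back a deleted vertex: on the side opposite \<open>B\<close>, or in
  the cut with at most one neighbour there. The bound on \<open>M'\<close> keeps control of the cut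
  when further vertices are put back.\<close>

lemma forest_sep_extend:
  assumes "forest_sep W E M B" and "v \<notin> W" and "nbrs E v \<inter> B = {} \<or> nbrs E v \<inter> M \<subseteq> {s}"
  obtains M' where "forest_sep (insert v W) E M' B" and "M' \<subseteq> insert v M"
  using assms(3)
proof
  assume "nbrs E v \<inter> B = {}"
  then show thesis using that[OF forest_sep_extend_side[OF assms(1,2)]] by blast
next
  assume "nbrs E v \<inter> M \<subseteq> {s}"
  moreover have "forest (induced_edges E M)" using assms(1) by (simp add: forest_sep_def)
  ultimately have "forest (induced_edges E (insert v M))" by (rule forest_insert_leaf[rotated])
  then show thesis using that[OF forest_sep_extend_forest[OF assms(1,2)]] by blast
qed

section \<open>Counting edges\<close>

lemma simple_graphD:
  assumes "simple_graph V E"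
  shows "finite V" and "finite E" and "{x, y} \<in> E \<Longrightarrow> x \<noteq> y \<and> x \<in> V \<and> y \<in> V"
    and "nbrs E v \<subseteq> V - {v}" and "finite (nbrs E v)"
proof -
  show fin: "finite V" using assms by (simp add: simple_graph_def)
  have "E \<subseteq> Pow V" using assms by (auto simp: simple_graph_def)
  then show "finite E" using fin by (meson finite_Pow_iff finite_subset)
  show *: "{x, y} \<in> E \<Longrightarrow> x \<noteq> y \<and> x \<in> V \<and> y \<in> V" for x y
    using assms by (fastforce simp: simple_graph_def)
  show "nbrs E v \<subseteq> V - {v}" using * by (auto simp: nbrs_def)
  then show "finite (nbrs E v)" using fin by (meson finite_Diff finite_subset)
qed

lemma card_edges_meeting_insert:
  assumes "simple_graph V E" and "v \<notin> D"
  shows "card {e \<in> E. e \<inter> insert v D \<noteq> {}} = card {e \<in> E. e \<inter> D \<noteq> {}} + card (nbrs E v - D)"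
proof -
  note G = simple_graphD[OF assms(1)]
  let ?N = "(\<lambda>u. {v, u}) ` (nbrs E v - D)"
  have "e \<in> ?N" if e: "e \<in> E" "v \<in> e" "e \<inter> D = {}" for e
  proof -
    have "card e = 2" using e assms(1) by (auto simp: simple_graph_def)
    then obtain u where "e = {v, u}" using e(2) by (metis card_2_iff insert_commute insertE singletonD)
    then show ?thesis using e by (auto simp: nbrs_def)
  qed
  then have "{e \<in> E. e \<inter> insert v D \<noteq> {}} = {e \<in> E. e \<inter> D \<noteq> {}} \<union> ?N"
    by (auto simp: nbrs_def)
  moreover have "{e \<in> E. e \<inter> D \<noteq> {}} \<inter> ?N = {}" using assms(2) by (auto simp: nbrs_def)
  moreover have "card ?N = card (nbrs E v - D)"
    by (rule card_image) (auto simp: inj_on_def doubleton_eq_iff)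
  ultimately show ?thesis using G by (simp add: card_Un_disjoint)
qed

lemma sum_degrees:
  assumes "simple_graph V E"
  shows "(\<Sum>v\<in>V. card (nbrs E v)) = 2 * card E"
proof -
  note G = simple_graphD[OF assms]
  have "card (nbrs E v) = card {e \<in> E. v \<in> e}" for v
    using card_edges_meeting_insert[OF assms, of v "{}"] by simp
  then have "(\<Sum>v\<in>V. card (nbrs E v)) = (\<Sum>v\<in>V. card {e \<in> E. v \<in> e})" by simp
  also have "\<dots> = 2 * card E"
  proof (rule sum_multicount[OF G(1,2)])
    show "\<forall>e\<in>E. card {v \<in> V. v \<in> e} = 2"
    proof
      fix e assume "e \<in> E"
      then have "card e = 2" "{v \<in> V. v \<in> e} = e" using assms by (auto simp: simple_graph_def)
      then show "card {v \<in> V. v \<in> e} = 2" by simp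
    qed
  qed
  finally show ?thesis .
qed

section \<open>Minimal counterexamples\<close>

lemma card_le_length: "S \<subseteq> set xs \<Longrightarrow> card S \<le> length xs"
  using card_mono[of "set xs" S] card_length[of xs] by simp

text \<open>For reductions that exceed their budget by a single new edge: one listed edge that is
  present or degenerate makes them affordable.\<close>

lemma card_new_edges:
  assumes "f \<in> set fs" and "f \<in> E \<or> card f \<noteq> 2"
  shows "card {e \<in> set fs - E. card e = 2} < length fs"
proof -
  have "{e \<in> set fs - E. card e = 2} \<subset> set fs" using assms by blast
  then have "card {e \<in> set fs - E. card e = 2} < card (set fs)" by (intro psubset_card_mono) simp
  also have "\<dots> \<le> length fs" by (rule card_length)
  finally show ?thesis .
qed

text \<open>The edge bound is cleared of its denominator to stay in \<open>nat\<close>. Minimality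
  within one vertex type suffices, because reductions only delete vertices and change edges.\<close>

locale minimal_counterexample =
  fixes V :: "'a set" and E :: "'a set set"
  assumes simple: "simple_graph V E"
    and card_V_ge4: "4 \<le> card V"
    and few_edges: "8 * card E + 28 < 19 * card V"
    and no_sep: "\<not> forest_sep V E M B"
    and minimal: "\<And>V' E'. simple_graph (V' :: 'a set) E' \<Longrightarrow> 4 \<le> card V' \<Longrightarrow> card V' < card V \<Longrightarrow>
      8 * card E' + 28 < 19 * card V' \<Longrightarrow> \<exists>M B. forest_sep V' E' M B"
begin

lemmas graph = simple_graphD[OF simple]

lemma edge_sym: "{x, y} \<in> E \<Longrightarrow> {y, x} \<in> E"
  by (simp add: insert_commute)

lemma nbrs_sym: "u \<in> nbrs E v \<Longrightarrow> v \<in> nbrs E u"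
  by (simp add: nbrs_def insert_commute)

text \<open>Deleting \<open>D\<close> and adding the edges \<open>F\<close> keeps the density below the threshold, so minimality
  yields a forest separation of the smaller graph. Elements of \<open>F\<close> may be singletons, which
  do not count as edges; this spares case distinctions when two of the named vertices coincide.\<close>

lemma reduction:
  assumes "D \<subseteq> V" and "D \<noteq> {}" and "card D + 4 \<le> card V" and F: "\<And>e. e \<in> F \<Longrightarrow> e \<subseteq> V - D"
    and cost: "19 * card D + 8 * card {e \<in> F - E. card e = 2} \<le> 8 * card {e \<in> E. e \<inter> D \<noteq> {}}"
  obtains M B where "forest_sep (V - D) (E \<union> F) M B"
proof -
  let ?E = "{e \<in> E \<union> F. card e = 2 \<and> e \<inter> D = {}}"
  have "F \<subseteq> Pow V" using F by blast
  then have "finite F" using graph(1) by (meson finite_Pow_iff finite_subset)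
  have finD: "finite D" using assms(1) graph(1) finite_subset by blast
  have s: "simple_graph (V - D) ?E"
    using simple F by (auto simp: simple_graph_def)
  have "?E \<subseteq> {e \<in> E. e \<inter> D = {}} \<union> {e \<in> F - E. card e = 2}" by blast
  then have "card ?E \<le> card ({e \<in> E. e \<inter> D = {}} \<union> {e \<in> F - E. card e = 2})"
    using graph(2) \<open>finite F\<close> by (intro card_mono) auto
  also have "\<dots> \<le> card {e \<in> E. e \<inter> D = {}} + card {e \<in> F - E. card e = 2}" by (rule card_Un_le)
  finally have 1: "card ?E \<le> card {e \<in> E. e \<inter> D = {}} + card {e \<in> F - E. card e = 2}" .
  have "card E = card ({e \<in> E. e \<inter> D = {}} \<union> {e \<in> E. e \<inter> D \<noteq> {}})"
    by (rule arg_cong[of _ _ card]) blast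
  also have "\<dots> = card {e \<in> E. e \<inter> D = {}} + card {e \<in> E. e \<inter> D \<noteq> {}}"
    using graph(2) by (intro card_Un_disjoint) auto
  finally have 2: "card E = card {e \<in> E. e \<inter> D = {}} + card {e \<in> E. e \<inter> D \<noteq> {}}" .
  have 3: "card (V - D) = card V - card D" using assms(1) finD by (simp add: card_Diff_subset)
  have "0 < card D" using assms(2) finD by (simp add: card_gt_0_iff)
  then obtain M B where sep: "forest_sep (V - D) ?E M B"
    using minimal[OF s] 1 2 3 cost assms(3) few_edges by fastforce
  then have sub: "M \<subseteq> V - D" "B \<subseteq> V - D" by (auto simp: forest_sep_def)
  \<comment> \<open>Restoring the singletons of \<open>F\<close> and the edges that meet
    \<open>D\<close> is harmless: none of them joins the two sides or lies on a cycle in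
    \<open>M\<close>.\<close>
  have "{a, b} \<notin> E \<union> F" if ab: "a \<in> V - D - M - B" "b \<in> B" for a b
  proof -
    have "a \<noteq> b" using ab by blast
    then have "card {a, b} = 2" "{a, b} \<inter> D = {}" using ab sub by auto
    then show ?thesis using ab sep by (auto simp: forest_sep_def)
  qed
  moreover have "forest (induced_edges (E \<union> F) M)"
    unfolding forest_def
  proof
    assume "\<exists>xs. cycle (induced_edges (E \<union> F) M) xs"
    then obtain xs where "cycle (induced_edges (E \<union> F) M) xs" by blast
    then have "cycle {e \<in> induced_edges (E \<union> F) M. card e = 2} xs" by (rule cycle_drop_loops)
    moreover have "{e \<in> induced_edges (E \<union> F) M. card e = 2} \<subseteq> induced_edges ?E M"
      using sub by (auto simp: induced_edges_def)
    ultimately show False using sep cycle_mono unfolding forest_sep_def forest_def by blast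
  qed
  ultimately have "forest_sep (V - D) (E \<union> F) M B"
    using sep by (simp add: forest_sep_def)
  then show ?thesis using that by blast
qed

text \<open>Otherwise \<open>N\<close> would be a forest cut separating \<open>X\<close> from
  \<open>y\<close>.\<close>

lemma nbhd_not_forest:
  assumes "X \<subseteq> V" and "X \<noteq> {}" and "N \<subseteq> V" and "X \<inter> N = {}" and "y \<in> V - X - N"
    and "\<And>x. x \<in> X \<Longrightarrow> nbrs E x \<subseteq> X \<union> N"
  shows "\<not> forest (induced_edges E N)"
proof
  assume f: "forest (induced_edges E N)"
  have "{a, b} \<notin> E" if "a \<in> V - N - X" "b \<in> X" for a b
    using assms(6)[OF that(2)] that by (auto simp: nbrs_def insert_commute)
  then have "forest_sep V E N X" using assms f by (auto simp: forest_sep_def)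
  then show False using no_sep by blast
qed

lemma no_extension:
  assumes "forest_sep (V - {v}) E M B" and "v \<in> V" and "nbrs E v \<inter> B = {} \<or> nbrs E v \<inter> M \<subseteq> {s}"
  shows False
proof -
  from forest_sep_extend[OF assms(1) _ assms(3)] obtain M' where
    "forest_sep (insert v (V - {v})) E M' B" by auto
  then show False using no_sep assms(2) by (simp add: insert_absorb)
qed

text \<open>Deleting \<open>v\<close> is affordable since \<open>19 \<le> 8 * 3\<close>. The
  neighbours, being a clique, avoid one side, and \<open>v\<close> can be put back on the
  other.\<close>

lemma not_simplicial:
  assumes "v \<in> V" and "5 \<le> card V" and "3 \<le> card (nbrs E v)"
    and "\<And>x y. x \<in> nbrs E v \<Longrightarrow> y \<in> nbrs E v \<Longrightarrow> x \<noteq> y \<Longrightarrow> {x, y} \<in> E"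
  shows False
proof -
  obtain M B where "forest_sep (V - {v}) (E \<union> {}) M B"
    using reduction[of "{v}" "{}"] assms card_edges_meeting_insert[OF simple, of v "{}"] by auto
  moreover have "nbrs E v \<subseteq> V - {v}" by (rule graph(4))
  ultimately obtain B' where "forest_sep (V - {v}) E M B'" "nbrs E v \<inter> B' = {}"
    using forest_sep_clique[of _ E M B "nbrs E v"] assms(4) by auto
  then show False using no_extension assms(1) by blast
qed

text \<open>With four vertices there are at most 5 edges, hence two nonadjacent vertices; the other
  two span at most one edge and separate them.\<close>

lemma card_V_ge5: "5 \<le> card V"
proof (rule ccontr)
  assume "\<not> ?thesis"
  then have c4: "card V = 4" using card_V_ge4 by simp
  have "\<exists>u\<in>V. \<exists>v\<in>V. u \<noteq> v \<and> {u, v} \<notin> E"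
  proof (rule ccontr)
    assume "\<not> ?thesis"
    then have "{e. e \<subseteq> V \<and> card e = 2} \<subseteq> E" by (auto simp: card_2_iff)
    then have "card {e. e \<subseteq> V \<and> card e = 2} \<le> card E" using graph(2) by (rule card_mono[rotated])
    then have "4 choose 2 \<le> card E" using n_subsets[OF graph(1), of 2] c4 by simp
    then show False using few_edges c4 by (simp add: choose_two)
  qed
  then obtain u v where uv: "u \<in> V" "v \<in> V" "u \<noteq> v" "{u, v} \<notin> E" by blast
  let ?N = "V - {u, v}"
  have "card ?N = 2" using uv c4 graph(1) by (simp add: card_Diff_subset)
  have "\<not> forest (induced_edges E ?N)"
    using uv graph(3,4) by (intro nbhd_not_forest[of "{u}" _ v]) (auto simp: nbrs_def)
  moreover have "{a, b} = ?N" if "a \<in> ?N" "b \<in> ?N" "a \<noteq> b" for a b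
    using that \<open>card ?N = 2\<close> graph(1) by (intro card_subset_eq) auto
  then have "forest (induced_edges E ?N)" by (intro forest_single_edge[where f = ?N])
  ultimately show False by blast
qed

section \<open>Minimum degree and number of vertices\<close>

lemma nbrs_not_forest:
  assumes "v \<in> V" and "card (nbrs E v) + 2 \<le> card V"
  shows "\<not> forest (induced_edges E (nbrs E v))"
proof -
  have "card (insert v (nbrs E v)) < card V"
    using assms(2) card_insert_le_m1[of "card (nbrs E v) + 1" "nbrs E v" v] by simp
  then have "\<not> V \<subseteq> insert v (nbrs E v)" using graph(5) by (meson card_mono finite_insert not_le)
  then obtain y where "y \<in> V - {v} - nbrs E v" by blast
  then show ?thesis
    using assms(1) graph(4)[of v] by (intro nbhd_not_forest[of "{v}" _ y]) auto
qed

text \<open>A cycle among at most three neighbours is a triangle on all of them, so the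
  neighbourhood is a clique.\<close>

lemma min_degree:
  assumes "v \<in> V"
  shows "4 \<le> card (nbrs E v)"
proof (rule ccontr)
  assume "\<not> ?thesis"
  then have le3: "card (nbrs E v) \<le> 3" by simp
  then have "\<not> forest (induced_edges E (nbrs E v))"
    using assms card_V_ge5 by (intro nbrs_not_forest) auto
  from not_forest_small[OF this graph(5)] le3 obtain x y z where
    xyz: "{x, y, z} \<subseteq> nbrs E v" "distinct [x, y, z]" "{x, y} \<in> E" "{y, z} \<in> E" "{x, z} \<in> E"
    by fastforce
  then have "card {x, y, z} = 3" by simp
  then have "nbrs E v = {x, y, z}"
    using le3 xyz(1) graph(5) by (metis card_seteq)
  moreover have "{s, t} \<in> E" if "s \<in> {x, y, z}" "t \<in> {x, y, z}" "s \<noteq> t" for s t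
    using that xyz(3-) xyz(3-)[THEN edge_sym] by blast
  moreover have "3 \<le> card (nbrs E v)" using \<open>card {x, y, z} = 3\<close> calculation(1) by simp
  ultimately show False using not_simplicial[OF assms card_V_ge5] by metis
qed

text \<open>From \<open>16 n \<le> 8 |E| < 19 n - 28\<close>. This makes room for deleting up to
  three vertices and for a vertex outside each configuration below.\<close>

lemma card_V_ge10: "10 \<le> card V"
proof -
  have "card V * 4 \<le> (\<Sum>v\<in>V. card (nbrs E v))"
    using sum_bounded_below[of V 4 "\<lambda>v. card (nbrs E v)"] min_degree by simp
  then show ?thesis using sum_degrees[OF simple] few_edges by simp
qed

lemma vertex_outside:
  assumes "length xs < 10"
  obtains y where "y \<in> V" and "y \<notin> set xs"
proof -
  have "\<not> V \<subseteq> set xs" using card_le_length[of V xs] assms card_V_ge10 by auto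
  then show ?thesis using that by blast
qed

section \<open>Neighbourhoods of vertices of degree 4\<close>

lemma card_edges_meeting1: "card {e \<in> E. e \<inter> {v} \<noteq> {}} = card (nbrs E v)"
  using card_edges_meeting_insert[OF simple, of v "{}"] by simp

text \<open>If \<open>u\<close> and \<open>c\<close> are adjacent, adding \<open>{a, b}\<close>
  makes the neighbourhood a clique. Otherwise \<open>{u, c}\<close> is added, which turns
  \<open>u\<close>, \<open>c\<close>, \<open>a\<close> into a triangle, so that only
  \<open>b\<close> can lie in the side \<open>B'\<close>.\<close>

lemma nbrs_no_four_cycle:
  assumes v: "v \<in> V" and n: "nbrs E v = {u, a, c, b}" and d: "distinct [u, a, c, b]"
    and e: "{u, a} \<in> E" "{a, c} \<in> E" "{c, b} \<in> E" "{b, u} \<in> E"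
  shows False
proof -
  have deg: "card (nbrs E v) = 4" using n d by simp
  have sub: "{u, a, c, b} \<subseteq> V - {v}" using graph(4)[of v] n by simp
  \<comment> \<open>One edge may be added, as \<open>19 + 8 \<le> 8 * 4\<close>.\<close>
  have red: thesis if "\<And>M B. forest_sep (V - {v}) (E \<union> {f}) M B \<Longrightarrow> thesis" "f \<subseteq> V - {v}" for f thesis
  proof -
    have "card {e \<in> {f} - E. card e = 2} \<le> length [f]" by (rule card_le_length) auto
    then have cost: "19 * card {v} + 8 * card {e \<in> {f} - E. card e = 2} \<le> 8 * card {e \<in> E. e \<inter> {v} \<noteq> {}}"
      unfolding card_edges_meeting1 deg by simp
    show thesis
      by (rule reduction[OF _ _ _ _ cost that(1)]) (use v card_V_ge5 that(2) in auto)
  qed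
  show False
  proof (cases "{u, c} \<in> E")
    case True
    obtain M B where "forest_sep (V - {v}) (E \<union> {{a, b}}) M B" using red[of "{a, b}"] sub by auto
    moreover have "{x, y} \<in> E \<union> {{a, b}}" if "x \<in> nbrs E v" "y \<in> nbrs E v" "x \<noteq> y" for x y
      using that True e edge_sym[OF True] e[THEN edge_sym] unfolding n
      by (elim insertE) (simp_all add: doubleton_eq_iff)
    ultimately obtain B' where B': "forest_sep (V - {v}) (E \<union> {{a, b}}) M B'" "nbrs E v \<inter> B' = {}"
      using forest_sep_clique[of "V - {v}" "E \<union> {{a, b}}" M B "nbrs E v"] sub n by metis
    then have "forest_sep (V - {v}) E M B'" by (auto intro: forest_sep_mono)
    then show False using no_extension[OF _ v] B'(2) by blast
  next
    case False
    obtain M B where S: "forest_sep (V - {v}) (E \<union> {{u, c}}) M B" using red[of "{u, c}"] sub by auto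
    moreover have "{x, y} \<in> E \<union> {{u, c}}" if "x \<in> {u, c, a}" "y \<in> {u, c, a}" "x \<noteq> y" for x y
      using that e e[THEN edge_sym] by (elim insertE) (simp_all add: doubleton_eq_iff)
    ultimately obtain B' where B': "forest_sep (V - {v}) (E \<union> {{u, c}}) M B'" "{u, c, a} \<inter> B' = {}"
      using forest_sep_clique[of "V - {v}" "E \<union> {{u, c}}" M B "{u, c, a}"] sub by auto
    then have S': "forest_sep (V - {v}) E M B'" by (auto intro: forest_sep_mono)
    show False
    proof (cases "b \<in> B' \<and> a \<notin> M")
      case False
      show False
      proof (cases "b \<in> B'")
        case True
        then have "a \<in> M" "b \<notin> M" using False S' by (auto simp: forest_sep_def)
        \<comment> \<open>The neighbours \<open>u\<close> and \<open>c\<close> of \<open>b\<close>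
          are forced into the cut, where they form a triangle with \<open>a\<close>.\<close>
        have "u \<notin> V - {v} - M - B'" "c \<notin> V - {v} - M - B'"
          using True S' e[THEN edge_sym] e by (auto simp: forest_sep_def)
        then have "{u, c, a} \<subseteq> M" using sub B'(2) \<open>a \<in> M\<close> by auto
        then show False
          using forest_no_triangle[of "E \<union> {{u, c}}" M u c a] B'(1) d e e[THEN edge_sym]
          by (auto simp: forest_sep_def)
      next
        case False
        then show False using no_extension[OF S' v] B'(2) n by auto
      qed
    next
      case True
      have "u \<notin> V - {v} - M - B'" "c \<notin> V - {v} - M - B'"
        using True S' e[THEN edge_sym] e by (auto simp: forest_sep_def)
      then have "u \<in> M" "c \<in> M" using sub B'(2) by auto
      moreover have "b \<notin> M" using True S' by (auto simp: forest_sep_def)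
      ultimately have "nbrs E v \<inter> M \<subseteq> {u, c}" using n True by auto
      moreover have "forest (induced_edges (insert {u, c} E) M)"
        using B'(1) by (simp add: forest_sep_def)
      \<comment> \<open>Here \<open>v\<close> subdivides the added edge \<open>{u, c}\<close> of the
        cut.\<close>
      ultimately have "forest (induced_edges E (insert v M))"
        using forest_subdivide_edge[OF _ _ \<open>{u, c} \<notin> E\<close>] by blast
      then have "forest_sep (insert v (V - {v})) E (insert v M) B'"
        by (intro forest_sep_extend_forest S') auto
      then show False using no_sep v by (simp add: insert_absorb)
    qed
  qed
qed

lemma degree4_triangle:
  assumes "v \<in> V" and "card (nbrs E v) = 4"
  obtains p q r d where "nbrs E v = {p, q, r, d}" and "distinct [p, q, r, d]"
    and "{p, q} \<in> E" and "{q, r} \<in> E" and "{p, r} \<in> E"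
proof -
  have "\<not> forest (induced_edges E (nbrs E v))"
    using assms card_V_ge10 by (intro nbrs_not_forest) auto
  from not_forest_small[OF this graph(5)] assms nbrs_no_four_cycle obtain x y z where
    xyz: "{x, y, z} \<subseteq> nbrs E v" "distinct [x, y, z]" "{x, y} \<in> E" "{y, z} \<in> E" "{x, z} \<in> E"
    by (metis order_refl)
  then have "card (nbrs E v - {x, y, z}) = 1" using assms(2) by (simp add: card_Diff_subset)
  then obtain d where "nbrs E v - {x, y, z} = {d}" by (meson card_1_singletonE)
  then have "nbrs E v = {x, y, z, d}" "d \<notin> {x, y, z}" using xyz(1) by blast+
  then show ?thesis using that[of x y z d] xyz by auto
qed

text \<open>Otherwise \<open>d\<close>, \<open>p\<close>, \<open>r\<close>, \<open>q\<close> form a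
  four-cycle. This makes the triangle of a degree-4 vertex unique.\<close>

lemma outside_triangle:
  assumes "v \<in> V" and "nbrs E v = {p, q, r, d}" and "distinct [p, q, r, d]"
    and "{p, r} \<in> E" and "{q, r} \<in> E" and "d \<in> nbrs E p" and "d \<in> nbrs E q"
  shows False
proof (rule nbrs_no_four_cycle[OF assms(1)])
  show "nbrs E v = {d, p, r, q}" using assms(2) by blast
  show "distinct [d, p, r, q]" using assms(3) by auto
  show "{d, p} \<in> E" "{p, r} \<in> E" "{r, q} \<in> E" "{q, d} \<in> E"
    using assms(4-) edge_sym by (auto simp: nbrs_def)
qed

section \<open>Two reducible configurations\<close>

text \<open>Contracts \<open>v\<close> into \<open>d\<close>, deletes \<open>q\<close> and adds the edge \<open>d d'\<close>. In the smaller graph \<open>T\<close> and \<open>d\<close> form a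
  clique, so \<open>v\<close> can be put back on the side of that clique; \<open>q\<close> then either joins the same side or
  is a leaf in the cut.\<close>

lemma no_twins:
  assumes vq: "v \<in> V" "q \<in> V" "v \<noteq> q"
    and T: "T \<subseteq> V - {v, q}" "\<And>s t. s \<in> T \<Longrightarrow> t \<in> T \<Longrightarrow> s \<noteq> t \<Longrightarrow> {s, t} \<in> E"
    and d: "d \<in> V - {v, q}" "d' \<in> V - {v, q}" "d \<notin> T"
    and n: "nbrs E v \<subseteq> insert q (insert d T)" "nbrs E q \<subseteq> insert v (insert d' T)"
    and cost: "38 + 8 * card {e \<in> insert {d, d'} ((\<lambda>t. {t, d}) ` T) - E. card e = 2}
      \<le> 8 * card {e \<in> E. e \<inter> {v, q} \<noteq> {}}"
  shows False
proof -
  let ?F = "insert {d, d'} ((\<lambda>t. {t, d}) ` T)"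
  let ?W = "V - {v, q}"
  obtain M B0 where "forest_sep ?W (E \<union> ?F) M B0"
    using reduction[of "{v, q}" ?F] vq T(1) d cost card_V_ge10 by auto
  moreover have "insert d T \<subseteq> ?W" using T d by blast
  moreover have "{x, y} \<in> E \<union> ?F" if "x \<in> insert d T" "y \<in> insert d T" "x \<noteq> y" for x y
    using that T(2) by (auto simp: insert_commute)
  ultimately obtain B where S: "forest_sep ?W (E \<union> ?F) M B" and B: "insert d T \<inter> B = {}"
    using forest_sep_clique[of ?W "E \<union> ?F" M B0 "insert d T"] by blast
  have sub: "M \<subseteq> ?W" "B \<subseteq> ?W - M" using S by (auto simp: forest_sep_def)
  have "forest_sep ?W E M B" using S by (rule forest_sep_mono) blast
  moreover have "nbrs E v \<inter> B = {}" using n(1) B sub by blast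
  ultimately have "forest_sep (insert v ?W) E M B" by (intro forest_sep_extend_side) auto
  moreover have "insert v ?W = V - {q}" using vq by blast
  ultimately have S1: "forest_sep (V - {q}) E M B" by simp
  have "\<exists>s. nbrs E q \<inter> B = {} \<or> nbrs E q \<inter> M \<subseteq> {s}"
  proof (cases "d' \<in> B")
    case True
    \<comment> \<open>The new edge \<open>{d, d'}\<close> forces \<open>d\<close> into the cut,
      where it would form a triangle with any two vertices of \<open>T\<close>.\<close>
    then have "d \<in> M" using S B d by (auto simp: forest_sep_def)
    have "s = t" if "s \<in> T \<inter> M" "t \<in> T \<inter> M" for s t
    proof (rule ccontr)
      assume "s \<noteq> t"
      then show False
        using that \<open>d \<in> M\<close> S T(2) d(3) forest_no_triangle[of "E \<union> ?F" M s t d]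
        by (auto simp: forest_sep_def)
    qed
    then have "\<exists>s. T \<inter> M \<subseteq> {s}" by blast
    moreover have "nbrs E q \<inter> M \<subseteq> T \<inter> M" using n(2) True sub by blast
    ultimately show ?thesis by blast
  next
    case False
    then have "nbrs E q \<inter> B = {}" using n(2) B sub by blast
    then show ?thesis by blast
  qed
  then show False using no_extension[OF S1 vq(2)] by blast
qed

text \<open>Deletes \<open>w\<close>, \<open>v1\<close> and \<open>v2\<close>, completes the triangle \<open>x y z\<close> and joins \<open>d1\<close>, \<open>d2\<close> to the triangle
  vertices \<open>c1\<close>, \<open>c2\<close> not adjacent to \<open>v1\<close>, \<open>v2\<close>. If \<open>d1\<close> is separated from the triangle, then \<open>c1\<close> is in
  the cut, hence at most one of the other two is, and \<open>v1\<close> is a leaf in the cut.\<close>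

lemma no_hub:
  assumes D: "w \<in> V" "v1 \<in> V" "v2 \<in> V" "distinct [w, v1, v2]"
    and K: "{x, y, z} \<subseteq> V - {w, v1, v2}" "distinct [x, y, z]"
    and d: "d1 \<in> V - {w, v1, v2}" "d2 \<in> V - {w, v1, v2}"
    and c: "c1 \<in> {x, y, z}" "c2 \<in> {x, y, z}"
    and n: "nbrs E w \<subseteq> {x, y, z, v1, v2}"
      "nbrs E v1 \<subseteq> insert w (insert d1 ({x, y, z} - {c1}))"
      "nbrs E v2 \<subseteq> insert w (insert d2 ({x, y, z} - {c2}))"
    and cost: "57 + 8 * card {e \<in> {{x, y}, {y, z}, {x, z}, {d1, c1}, {d2, c2}} - E. card e = 2}
      \<le> 8 * card {e \<in> E. e \<inter> {w, v1, v2} \<noteq> {}}"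
  shows False
proof -
  let ?F = "{{x, y}, {y, z}, {x, z}, {d1, c1}, {d2, c2}}"
  let ?D = "{w, v1, v2}"
  let ?W = "V - ?D"
  have "card ?D = 3" using D(4) by simp
  moreover have "?D \<subseteq> V" using D by simp
  moreover have "e \<subseteq> V - ?D" if "e \<in> ?F" for e using that K(1) d c by auto
  ultimately obtain M B0 where "forest_sep ?W (E \<union> ?F) M B0"
    using reduction[of ?D ?F] cost card_V_ge10 by auto
  moreover have "{s, t} \<in> E \<union> ?F" if "s \<in> {x, y, z}" "t \<in> {x, y, z}" "s \<noteq> t" for s t
    using that by (auto simp: insert_commute)
  ultimately obtain B where S: "forest_sep ?W (E \<union> ?F) M B" and B: "{x, y, z} \<inter> B = {}"
    using forest_sep_clique[of ?W "E \<union> ?F" M B0 "{x, y, z}"] K(1) by blast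
  have sub: "M \<subseteq> ?W" "B \<subseteq> ?W - M" using S by (auto simp: forest_sep_def)
  have "\<not> {x, y, z} \<subseteq> M"
    using S K(2) forest_no_triangle[of "E \<union> ?F" M x y z] by (auto simp: forest_sep_def)
  then have "s = t" if "c \<in> M" "c \<in> {x, y, z}" "s \<in> ({x, y, z} - {c}) \<inter> M" "t \<in> ({x, y, z} - {c}) \<inter> M"
    for c s t using that by auto
  then have two: "\<exists>s. ({x, y, z} - {c}) \<inter> M \<subseteq> {s}" if "c \<in> M" "c \<in> {x, y, z}" for c
    using that by blast
  have key: "\<exists>s. N \<inter> B = {} \<or> N \<inter> M \<subseteq> {s}"
    if N: "N \<subseteq> insert w (insert d ({x, y, z} - {c}))" and "c \<in> {x, y, z}" "{d, c} \<in> ?F" for N d c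
  proof (cases "d \<in> B")
    case True
    have "c \<notin> B" "c \<in> ?W" using that(2) B K(1) by auto
    moreover have "{c, d} \<in> E \<union> ?F" using that(3) by (subst insert_commute) blast
    ultimately have "c \<in> M" using S True unfolding forest_sep_def by blast
    moreover have "N \<inter> M \<subseteq> ({x, y, z} - {c}) \<inter> M" using N True sub by blast
    ultimately show ?thesis using two[OF _ that(2)] by (meson subset_trans)
  next
    case False
    then have "N \<inter> B = {}" using N B sub by blast
    then show ?thesis by blast
  qed
  have "forest_sep ?W E M B" using S by (rule forest_sep_mono) blast
  moreover have "nbrs E w \<inter> B = {}" using n(1) B sub by blast
  ultimately have "forest_sep (insert w ?W) E M B" by (intro forest_sep_extend_side) auto
  moreover have "insert w ?W = V - {v1, v2}" using D by auto
  ultimately have S1: "forest_sep (V - {v1, v2}) E M B" by simp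
  obtain s1 where "nbrs E v1 \<inter> B = {} \<or> nbrs E v1 \<inter> M \<subseteq> {s1}"
    using key[OF n(2) c(1)] by auto
  then obtain M1 where M1: "forest_sep (insert v1 (V - {v1, v2})) E M1 B" "M1 \<subseteq> insert v1 M"
    using forest_sep_extend[OF S1, of v1 s1] by auto
  moreover have "insert v1 (V - {v1, v2}) = V - {v2}" using D by auto
  ultimately have S2: "forest_sep (V - {v2}) E M1 B" by simp
  obtain s2 where "nbrs E v2 \<inter> B = {} \<or> nbrs E v2 \<inter> M \<subseteq> {s2}"
    using key[OF n(3) c(2)] by auto
  \<comment> \<open>The cut may have gained \<open>v1\<close>; as \<open>v1\<close> is not adjacent
    to \<open>v2\<close>, the bound for \<open>M\<close> carries over to \<open>M1\<close>.\<close>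
  moreover have "v1 \<notin> nbrs E v2" using n(3) D(4) K(1) d by auto
  ultimately have "nbrs E v2 \<inter> B = {} \<or> nbrs E v2 \<inter> M1 \<subseteq> {s2}" using M1(2) by blast
  then show False using no_extension[OF S2 D(3)] by blast
qed

section \<open>Discharging\<close>

text \<open>Listing the neighbours with \<open>u\<close> first spares symmetric cases; the four
  distinct entries build in that \<open>v\<close> has degree 4.\<close>

definition strong :: "'a \<Rightarrow> 'a \<Rightarrow> bool" where
  "strong v u \<longleftrightarrow> v \<in> V \<and> (\<exists>p q d. nbrs E v = {u, p, q, d} \<and> distinct [u, p, q, d] \<and>
     {u, p} \<in> E \<and> {p, q} \<in> E \<and> {u, q} \<in> E)"

lemma strong_triangle:
  assumes "v \<in> V" and n: "nbrs E v = {p, q, r, d}" and d: "distinct [p, q, r, d]"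
    and e: "{p, q} \<in> E" "{q, r} \<in> E" "{p, r} \<in> E"
  shows "strong v p" and "strong v q" and "strong v r"
proof -
  show "strong v p" unfolding strong_def using assms by blast
  have "nbrs E v = {q, p, r, d}" "distinct [q, p, r, d]" using n d by auto
  then show "strong v q" unfolding strong_def using assms(1) e e[THEN edge_sym] by blast
  have "nbrs E v = {r, p, q, d}" "distinct [r, p, q, d]" using n d by auto
  then show "strong v r" unfolding strong_def using assms(1) e e[THEN edge_sym] by blast
qed

lemma strong_card:
  assumes "strong v u"
  shows "v \<in> V" and "card (nbrs E v) = 4" and "u \<in> nbrs E v" and "v \<in> nbrs E u" and "u \<in> V"
proof -
  show "v \<in> V" using assms by (simp add: strong_def)
  obtain p q d where "nbrs E v = {u, p, q, d}" "distinct [u, p, q, d]"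
    using assms by (auto simp: strong_def)
  then show "card (nbrs E v) = 4" "u \<in> nbrs E v" by simp_all
  then show "v \<in> nbrs E u" "u \<in> V" using nbrs_sym graph(4) by blast+
qed

section \<open>Degrees of strong neighbours\<close>

text \<open>If two degree-4 vertices \<open>v\<close> and \<open>q\<close> share a triangle with two common neighbours \<open>p\<close>, \<open>r\<close>
  and have the further neighbours \<open>d\<close>, \<open>d'\<close>, then either \<open>no_twins\<close> applies to \<open>v, q\<close> or to \<open>q, v\<close>, or
  \<open>{p, r, d, d'}\<close> spans a single edge and cuts off \<open>{v, q}\<close>.\<close>

lemma strong_degree:
  assumes "strong v q"
  shows "5 \<le> card (nbrs E q)"
proof (rule ccontr)
  assume le4: "\<not> ?thesis"
  note vq = strong_card[OF assms]
  have q4: "card (nbrs E q) = 4" using min_degree[OF vq(5)] le4 by simp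
  obtain p r d where n: "nbrs E v = {q, p, r, d}" and dist: "distinct [q, p, r, d]"
    and e: "{q, p} \<in> E" "{p, r} \<in> E" "{q, r} \<in> E"
    using assms by (auto simp: strong_def)
  have vN: "v \<notin> {q, p, r, d}" using graph(4)[of v] n by blast
  have "{v, p, r} \<subseteq> nbrs E q" using e vq(4) by (auto simp: nbrs_def)
  moreover have "card {v, p, r} = 3" using vN dist by simp
  ultimately have "card (nbrs E q - {v, p, r}) = 1" using q4 by (simp add: card_Diff_subset)
  then obtain d' where "nbrs E q - {v, p, r} = {d'}" by (meson card_1_singletonE)
  then have nq: "nbrs E q = {v, p, r, d'}" and d': "d' \<notin> {v, p, r}"
    using \<open>{v, p, r} \<subseteq> nbrs E q\<close> by blast+
  have "d' \<noteq> q" using graph(4)[of q] nq by blast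
  have inV: "{v, q, p, r, d, d'} \<subseteq> V" using graph(4)[of q] graph(4)[of v] n nq vq(1,5) by auto
  have "card {e \<in> E. e \<inter> {v, q} \<noteq> {}} = card (nbrs E q) + card (nbrs E v - {q})"
    using card_edges_meeting_insert[OF simple, of v "{q}"] vN card_edges_meeting1 by simp
  moreover have "nbrs E v - {q} = {p, r, d}" using n dist by auto
  ultimately have lost: "card {e \<in> E. e \<inter> {v, q} \<noteq> {}} = 7" using q4 dist by simp
  have T: "{s, t} \<in> E" if "s \<in> {p, r}" "t \<in> {p, r}" "s \<noteq> t" for s t
    using that e(2) edge_sym[OF e(2)] by blast
  \<comment> \<open>Seven lost edges pay for two new ones, as \<open>38 + 8 * 2 \<le> 8 * 7\<close>.
    So a contradiction arises once one of the three is present or degenerate.\<close>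
  have tw1: False if "f \<in> {{d, d'}, {p, d}, {r, d}}" "f \<in> E \<or> card f \<noteq> 2" for f
  proof (rule no_twins[of v q "{p, r}" d d'])
    have "card {e \<in> {{d, d'}, {p, d}, {r, d}} - E. card e = 2} < 3"
      using card_new_edges[of f "[{d, d'}, {p, d}, {r, d}]" E] that by simp
    then show "38 + 8 * card {e \<in> insert {d, d'} ((\<lambda>t. {t, d}) ` {p, r}) - E. card e = 2}
        \<le> 8 * card {e \<in> E. e \<inter> {v, q} \<noteq> {}}"
      unfolding lost by simp
  qed (use T vN d' \<open>d' \<noteq> q\<close> dist inV n nq in auto)
  have tw2: False if "f \<in> {{d', d}, {p, d'}, {r, d'}}" "f \<in> E \<or> card f \<noteq> 2" for f
  proof (rule no_twins[of q v "{p, r}" d' d])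
    have "card {e \<in> {{d', d}, {p, d'}, {r, d'}} - E. card e = 2} < 3"
      using card_new_edges[of f "[{d', d}, {p, d'}, {r, d'}]" E] that by simp
    then show "38 + 8 * card {e \<in> insert {d', d} ((\<lambda>t. {t, d'}) ` {p, r}) - E. card e = 2}
        \<le> 8 * card {e \<in> E. e \<inter> {q, v} \<noteq> {}}"
      unfolding lost insert_commute[of q v] by simp
  qed (use T vN d' \<open>d' \<noteq> q\<close> dist inV n nq in auto)
  have "d \<noteq> d'" using tw1[of "{d, d'}"] by auto
  have no_edge: "{d, d'} \<notin> E" "{p, d} \<notin> E" "{r, d} \<notin> E" "{p, d'} \<notin> E" "{r, d'} \<notin> E"
    using tw1[of "{d, d'}"] tw1[of "{p, d}"] tw1[of "{r, d}"] tw2[of "{p, d'}"] tw2[of "{r, d'}"]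
    by blast+
  have "{a, b} = {p, r}" if "a \<in> {p, r, d, d'}" "b \<in> {p, r, d, d'}" "{a, b} \<in> E" "a \<noteq> b" for a b
    using that edge_sym[OF that(3)] no_edge
    by (elim insertE emptyE) (simp_all add: insert_commute)
  then have "forest (induced_edges E {p, r, d, d'})" by (rule forest_single_edge)
  moreover obtain y where "y \<in> V" "y \<notin> set [v, q, p, r, d, d']"
    by (rule vertex_outside[of "[v, q, p, r, d, d']"]) simp
  moreover have "{v, q} \<inter> {p, r, d, d'} = {}" using vN d' \<open>d' \<noteq> q\<close> dist by auto
  moreover have "nbrs E u \<subseteq> {v, q} \<union> {p, r, d, d'}" if "u \<in> {v, q}" for u
    using that n nq by auto
  ultimately show False
    using nbhd_not_forest[of "{v, q}" "{p, r, d, d'}" y] inV by simp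
qed

section \<open>Strong neighbours of degree 5 and 6\<close>

lemma card_edges_meeting_hub:
  assumes n: "nbrs E w = {v1, v2, x, y, z}" "distinct [v1, v2, x, y, z]"
    and d: "card (nbrs E v1) = 4" "card (nbrs E v2) = 4" "v2 \<notin> nbrs E v1" "w \<noteq> v1" "w \<noteq> v2"
  shows "card {e \<in> E. e \<inter> {w, v1, v2} \<noteq> {}} = 11" and "card {e \<in> E. e \<inter> {v1, v2} \<noteq> {}} = 8"
proof -
  have "nbrs E v1 - {v2} = nbrs E v1" using d(3) by blast
  then show 8: "card {e \<in> E. e \<inter> {v1, v2} \<noteq> {}} = 8"
    using card_edges_meeting_insert[OF simple, of v1 "{v2}"] d n(2) card_edges_meeting1 by simp
  have "nbrs E w - {v1, v2} = {x, y, z}" using n by auto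
  then show "card {e \<in> E. e \<inter> {w, v1, v2} \<noteq> {}} = 11"
    using card_edges_meeting_insert[OF simple, of w "{v1, v2}"] d n(2) 8 by simp
qed

text \<open>The triangles of \<open>v1\<close> and \<open>v2\<close> share just \<open>w\<close> and
  \<open>y\<close>. Only \<open>{x, z}\<close>, \<open>{d1, z}\<close> and \<open>{d2, x}\<close>
  can be new, and \<open>57 + 8 * 3 \<le> 8 * 11\<close>.\<close>

lemma no_hub_path:
  assumes V: "w \<in> V" "v1 \<in> V" "v2 \<in> V"
    and nw: "nbrs E w = {v1, v2, x, y, z}" "distinct [v1, v2, x, y, z]"
    and n1: "nbrs E v1 = {w, x, y, d1}" "distinct [w, x, y, d1]"
    and n2: "nbrs E v2 = {w, y, z, d2}" "distinct [w, y, z, d2]"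
    and e: "{x, y} \<in> E" "{y, z} \<in> E" and na: "v2 \<notin> nbrs E v1"
  shows False
proof -
  have ne: "w \<noteq> v1" "w \<noteq> v2" using graph(4)[of w] nw by auto
  have "d1 \<notin> {w, v1, v2}" "d2 \<notin> {w, v1, v2}"
    using n1 n2 na nbrs_sym[of v1 v2] graph(4)[of v1] graph(4)[of v2] by auto
  moreover have "{x, y, z} \<inter> {w, v1, v2} = {}" using nw graph(4)[of w] by auto
  moreover have "{x, y, z, d1, d2} \<subseteq> V"
    using graph(4)[of w] graph(4)[of v1] graph(4)[of v2] unfolding nw(1) n1(1) n2(1) by auto
  moreover have "card {e \<in> {{x, y}, {y, z}, {x, z}, {d1, z}, {d2, x}} - E. card e = 2}
      \<le> length [{x, z}, {d1, z}, {d2, x}]"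
    by (rule card_le_length) (use e in auto)
  moreover have "card {e \<in> E. e \<inter> {w, v1, v2} \<noteq> {}} = 11"
    using card_edges_meeting_hub(1)[OF nw _ _ na ne] n1 n2 by simp
  ultimately show False
    using no_hub[of w v1 v2 x y z d1 d2 z x] V ne nw n1 n2 by auto
qed

text \<open>The triangles coincide. Both \<open>no_hub\<close> (\<open>57 + 8 * 4 > 8 * 11\<close>)
  and \<open>no_twins\<close> (\<open>38 + 8 * 4 > 8 * 8\<close>) fall short by one new edge, so
  none of the edges to be added is present. Then \<open>x\<close>, \<open>y\<close>,
  \<open>z\<close>, \<open>d1\<close>, \<open>d2\<close> span only \<open>{x, y}\<close> and cut off
  \<open>w\<close>, \<open>v1\<close>, \<open>v2\<close>.\<close>

lemma no_hub_fan:
  assumes V: "w \<in> V" "v1 \<in> V" "v2 \<in> V"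
    and nw: "nbrs E w = {v1, v2, x, y, z}" "distinct [v1, v2, x, y, z]"
    and n1: "nbrs E v1 = {w, x, y, d1}" "distinct [w, x, y, d1]"
    and n2: "nbrs E v2 = {w, x, y, d2}" "distinct [w, x, y, d2]"
    and e: "{x, y} \<in> E" and na: "v2 \<notin> nbrs E v1"
  shows False
proof -
  have ne: "w \<noteq> v1" "w \<noteq> v2" using graph(4)[of w] nw by auto
  have na': "v1 \<notin> nbrs E v2" using na nbrs_sym by blast
  have D: "d1 \<notin> {w, v1, v2}" "d2 \<notin> {w, v1, v2}"
    using n1 n2 na na' graph(4)[of v1] graph(4)[of v2] by auto
  have K: "{x, y, z} \<inter> {w, v1, v2} = {}" using nw graph(4)[of w] by auto
  have inV: "{x, y, z, d1, d2} \<subseteq> V"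
    using graph(4)[of w] graph(4)[of v1] graph(4)[of v2] unfolding nw(1) n1(1) n2(1) by auto
  have we: "{w, x} \<in> E" "{w, y} \<in> E" using nw by (auto simp: nbrs_def)
  have deg: "card (nbrs E v1) = 4" "card (nbrs E v2) = 4" using n1 n2 by simp_all
  note lost = card_edges_meeting_hub[OF nw deg na ne]
  have hub: False if "card {e \<in> {{y, z}, {x, z}, {d1, z}, {d2, z}} - E. card e = 2} < 4"
  proof (rule no_hub[of w v1 v2 x y z d1 d2 z z])
    show "57 + 8 * card {e \<in> {{x, y}, {y, z}, {x, z}, {d1, z}, {d2, z}} - E. card e = 2}
        \<le> 8 * card {e \<in> E. e \<inter> {w, v1, v2} \<noteq> {}}"
      unfolding lost using that by (simp only: insert_Diff1[OF e])
  qed (use V ne nw n1 n2 D K inV in auto)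
  have T: "{s, t} \<in> E" if "s \<in> {x, y, w}" "t \<in> {x, y, w}" "s \<noteq> t" for s t
    using that e we edge_sym[OF e] we[THEN edge_sym] by blast
  have tw1: False if "f \<in> {{d1, d2}, {x, d1}, {y, d1}, {w, d1}}" "f \<in> E" for f
  proof (rule no_twins[of v1 v2 "{x, y, w}" d1 d2])
    have "card {e \<in> {{d1, d2}, {x, d1}, {y, d1}, {w, d1}} - E. card e = 2} < 4"
      using card_new_edges[of f "[{d1, d2}, {x, d1}, {y, d1}, {w, d1}]" E] that by simp
    then show "38 + 8 * card {e \<in> insert {d1, d2} ((\<lambda>t. {t, d1}) ` {x, y, w}) - E. card e = 2}
        \<le> 8 * card {e \<in> E. e \<inter> {v1, v2} \<noteq> {}}"
      unfolding lost by simp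
  qed (use T V nw(2) n1 n2 D K inV ne in auto)
  have tw2: False if "f \<in> {{d2, d1}, {x, d2}, {y, d2}, {w, d2}}" "f \<in> E" for f
  proof (rule no_twins[of v2 v1 "{x, y, w}" d2 d1])
    have "card {e \<in> {{d2, d1}, {x, d2}, {y, d2}, {w, d2}} - E. card e = 2} < 4"
      using card_new_edges[of f "[{d2, d1}, {x, d2}, {y, d2}, {w, d2}]" E] that by simp
    then show "38 + 8 * card {e \<in> insert {d2, d1} ((\<lambda>t. {t, d2}) ` {x, y, w}) - E. card e = 2}
        \<le> 8 * card {e \<in> E. e \<inter> {v2, v1} \<noteq> {}}"
      unfolding lost insert_commute[of v2 v1] by simp
  qed (use T V nw(2) n1 n2 D K inV ne in auto)
  have "d1 \<noteq> d2"
  proof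
    assume "d1 = d2"
    then have "card {e \<in> {{y, z}, {x, z}, {d1, z}, {d2, z}} - E. card e = 2} \<le> length [{y, z}, {x, z}, {d1, z}]"
      by (intro card_le_length) auto
    then show False using hub by simp
  qed
  have hub': False if "f \<in> {{y, z}, {x, z}, {d1, z}, {d2, z}}" "f \<in> E" for f
    using card_new_edges[of f "[{y, z}, {x, z}, {d1, z}, {d2, z}]" E] that hub by simp
  have no_edge: "{x, z} \<notin> E" "{y, z} \<notin> E" "{d1, z} \<notin> E" "{d2, z} \<notin> E"
    "{x, d1} \<notin> E" "{y, d1} \<notin> E" "{d1, d2} \<notin> E" "{x, d2} \<notin> E" "{y, d2} \<notin> E"
    using hub'[of "{x, z}"] hub'[of "{y, z}"] hub'[of "{d1, z}"] hub'[of "{d2, z}"]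
      tw1[of "{x, d1}"] tw1[of "{y, d1}"] tw1[of "{d1, d2}"] tw2[of "{x, d2}"] tw2[of "{y, d2}"]
    by blast+
  have "{a, b} = {x, y}" if "a \<in> {x, y, z, d1, d2}" "b \<in> {x, y, z, d1, d2}" "{a, b} \<in> E" "a \<noteq> b" for a b
    using that edge_sym[OF that(3)] no_edge
    by (elim insertE emptyE) (simp_all add: insert_commute)
  then have "forest (induced_edges E {x, y, z, d1, d2})" by (rule forest_single_edge)
  moreover obtain u where "u \<in> V" "u \<notin> set [w, v1, v2, x, y, z, d1, d2]"
    by (rule vertex_outside[of "[w, v1, v2, x, y, z, d1, d2]"]) simp
  moreover have "{w, v1, v2} \<inter> {x, y, z, d1, d2} = {}" using D K by blast
  moreover have "nbrs E t \<subseteq> {w, v1, v2} \<union> {x, y, z, d1, d2}" if "t \<in> {w, v1, v2}" for t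
    using that nw(1) n1(1) n2(1) by auto
  ultimately show False
    using nbhd_not_forest[of "{w, v1, v2}" "{x, y, z, d1, d2}" u] V inV by simp
qed

text \<open>Triangle vertices have degree at least 5, so both triangles at \<open>w\<close> take
  their other vertices from the three neighbours of \<open>w\<close> besides \<open>v1\<close>,
  \<open>v2\<close>. The two pairs are equal (fan) or share one vertex (path).\<close>

lemma degree5_one_strong:
  assumes s1: "strong v1 w" and s2: "strong v2 w" and ne: "v1 \<noteq> v2" and deg: "card (nbrs E w) = 5"
  shows False
proof -
  note c1 = strong_card[OF s1] and c2 = strong_card[OF s2]
  obtain p q d1 where n1: "nbrs E v1 = {w, p, q, d1}" "distinct [w, p, q, d1]"
    and e1: "{w, p} \<in> E" "{p, q} \<in> E" "{w, q} \<in> E"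
    using s1 by (auto simp: strong_def)
  obtain p' q' d2 where n2: "nbrs E v2 = {w, p', q', d2}" "distinct [w, p', q', d2]"
    and e2: "{w, p'} \<in> E" "{p', q'} \<in> E" "{w, q'} \<in> E"
    using s2 by (auto simp: strong_def)
  have "strong v1 p" "strong v1 q"
    using strong_triangle[OF c1(1) n1 e1] by blast+
  then have pq: "v2 \<noteq> p" "v2 \<noteq> q" using strong_degree c2(2) by fastforce+
  have "strong v2 p'" "strong v2 q'"
    using strong_triangle[OF c2(1) n2 e2] by blast+
  then have pq': "v1 \<noteq> p'" "v1 \<noteq> q'" using strong_degree c1(2) by fastforce+
  have pqV: "v1 \<notin> {p, q}" "v2 \<notin> {p', q'}" using n1(1) n2(1) graph(4)[of v1] graph(4)[of v2] by auto
  have S: "{p, q} \<subseteq> nbrs E w - {v1, v2}" "{p', q'} \<subseteq> nbrs E w - {v1, v2}"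
    using e1 e2 pq pq' pqV by (auto simp: nbrs_def)
  have "card (nbrs E w - {v1, v2}) = 3" using deg c1(4) c2(4) ne by (simp add: card_Diff_subset)
  then have "card (nbrs E w - {v1, v2} - {p, q}) = 1" using S(1) n1(2) by (simp add: card_Diff_subset)
  then obtain z where z: "nbrs E w - {v1, v2} - {p, q} = {z}" by (meson card_1_singletonE)
  then have nw: "nbrs E w = {v1, v2, p, q, z}" and dw: "distinct [v1, v2, p, q, z]"
    using S(1) c1(4) c2(4) ne pq pqV n1(2) by auto
  have sub: "{p', q'} \<subseteq> {p, q, z}" using S(2) nw by blast
  \<comment> \<open>If adjacent to \<open>v1\<close>, the vertex \<open>v2\<close> is its fourth
    neighbour \<open>d1\<close>, but it is adjacent to \<open>w\<close> and to \<open>p\<close> or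
    \<open>q\<close>, two vertices of the triangle of \<open>v1\<close>.\<close>
  have na: "v2 \<notin> nbrs E v1"
  proof
    assume "v2 \<in> nbrs E v1"
    then have d1: "d1 = v2" using n1 pq c2(3,4) graph(4)[of w] by auto
    have "p \<in> {p', q'} \<or> q \<in> {p', q'}" using sub n2(2) by auto
    then have "p \<in> nbrs E v2 \<or> q \<in> nbrs E v2" using n2(1) by auto
    then show False
    proof
      assume "p \<in> nbrs E v2"
      then show False
        using outside_triangle[OF c1(1), of w p q d1] n1 e1 d1 c2(4) nbrs_sym by blast
    next
      assume "q \<in> nbrs E v2"
      moreover have "nbrs E v1 = {w, q, p, d1}" "distinct [w, q, p, d1]" using n1 by auto
      ultimately show False
        using outside_triangle[OF c1(1), of w q p d1] e1 e1[THEN edge_sym] d1 c2(4) nbrs_sym by blast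
    qed
  qed
  have n1': "nbrs E v1 = {w, q, p, d1}" "distinct [w, q, p, d1]" using n1 by auto
  have nw': "nbrs E w = {v1, v2, q, p, z}" "distinct [v1, v2, q, p, z]" using nw dw by auto
  consider "{p', q'} = {p, q}" | "{p', q'} = {q, z}" | "{p', q'} = {p, z}"
    using sub n2(2) by auto
  then show False
  proof cases
    case 1
    then have "nbrs E v2 = {w, p, q, d2}" "distinct [w, p, q, d2]" using n2 by auto
    then show False using no_hub_fan[OF c1(5,1) c2(1) nw dw n1] e1(2) na by blast
  next
    case 2
    then have "nbrs E v2 = {w, q, z, d2}" "distinct [w, q, z, d2]" "{q, z} \<in> E" using n2 e2 dw by auto
    then show False using no_hub_path[OF c1(5,1) c2(1) nw dw n1] e1(2) na by blast
  next
    case 3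
    then have "nbrs E v2 = {w, p, z, d2}" "distinct [w, p, z, d2]" "{p, z} \<in> E" using n2 e2 dw by auto
    then show False
      using no_hub_path[OF c1(5,1) c2(1) nw' n1'] edge_sym[OF e1(2)] na by blast
  qed
qed

text \<open>Charge 5 pays for five neighbours only. The triangle of a vertex \<open>v\<close> served
  by \<open>w\<close> contains a further neighbour of \<open>w\<close>; it has degree at least 5 and
  is not served.\<close>

lemma degree6_not_all_strong:
  assumes "w \<in> V" and "card (nbrs E w) = 6"
  shows "\<exists>v \<in> nbrs E w. \<not> strong v w"
proof (rule ccontr)
  assume "\<not> ?thesis"
  then have all: "strong v w" if "v \<in> nbrs E w" for v using that by blast
  have "nbrs E w \<noteq> {}" using assms(2) by auto
  then obtain v where v: "strong v w" using all by blast
  obtain p q d where n: "nbrs E v = {w, p, q, d}" "distinct [w, p, q, d]"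
    and e: "{w, p} \<in> E" "{p, q} \<in> E" "{w, q} \<in> E"
    using v by (auto simp: strong_def)
  have "strong v p" using strong_triangle(2)[OF strong_card(1)[OF v] n e] .
  then have "5 \<le> card (nbrs E p)" by (rule strong_degree)
  moreover have "p \<in> nbrs E w" using e(1) by (simp add: nbrs_def)
  then have "card (nbrs E p) = 4" using all strong_card(2) by blast
  ultimately show False by simp
qed

section \<open>Balance of charges\<close>

lemma strong_out:
  assumes v: "v \<in> V" "card (nbrs E v) = 4"
  shows "3 \<le> card {u \<in> V. strong v u}"
proof -
  obtain p q r d where n: "nbrs E v = {p, q, r, d}" "distinct [p, q, r, d]"
    and e: "{p, q} \<in> E" "{q, r} \<in> E" "{p, r} \<in> E"
    by (rule degree4_triangle[OF v])
  have "{p, q, r} \<subseteq> {u \<in> V. strong v u}"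
    using strong_triangle[OF v(1) n e] strong_card(5) by auto
  then have "card {p, q, r} \<le> card {u \<in> V. strong v u}" using graph(1) by (intro card_mono) auto
  then show ?thesis using n(2) by simp
qed

text \<open>The final charge at \<open>w\<close> is nonnegative, with the 19 moved to the left to
  avoid subtraction in \<open>nat\<close>. For degrees 5, 6 and at least 7 the initial charge is 1,
  5 and at least the degree.\<close>

lemma strong_in:
  assumes "w \<in> V"
  shows "card {v \<in> V. strong v w} + 19 \<le> 4 * card (nbrs E w) + (if card (nbrs E w) = 4 then 3 else 0)"
proof -
  let ?S = "{v \<in> V. strong v w}"
  have sub: "?S \<subseteq> nbrs E w" using strong_card(4) by blast
  then have le: "card ?S \<le> card (nbrs E w)" using graph(5) by (rule card_mono[rotated])
  have "4 \<le> card (nbrs E w)" using min_degree[OF assms] .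
  then consider "card (nbrs E w) = 4" | "card (nbrs E w) = 5" | "card (nbrs E w) = 6"
    | "7 \<le> card (nbrs E w)" by linarith
  then show ?thesis
  proof cases
    case 1
    then have "?S = {}" using strong_degree by fastforce
    then have "card ?S = 0" by (simp only: card.empty)
    then show ?thesis using 1 by simp
  next
    case 2
    then have "\<forall>a\<in>?S. \<forall>b\<in>?S. a = b" using degree5_one_strong by blast
    then have "card ?S \<le> Suc 0" using graph(1) by (subst card_le_Suc0_iff_eq) auto
    then show ?thesis using 2 by simp
  next
    case 3
    then have "?S \<subset> nbrs E w" using degree6_not_all_strong[OF assms] sub by blast
    then have "card ?S < card (nbrs E w)" using graph(5) by (intro psubset_card_mono)
    then show ?thesis using 3 by simp
  next
    case 4
    then show ?thesis using le by simp
  qed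
qed

lemma contradiction: False
proof -
  let ?d = "\<lambda>v. card (nbrs E v)"
  let ?b = "\<lambda>v. if ?d v = 4 then 3 else 0 :: nat"
  have "(\<Sum>v\<in>V. ?b v) \<le> (\<Sum>v\<in>V. card {u \<in> V. strong v u})"
    using strong_out by (intro sum_mono) auto
  \<comment> \<open>Double counting of the pairs related by \<open>strong\<close>.\<close>
  also have "\<dots> = (\<Sum>w\<in>V. card {v \<in> V. strong v w})"
    using sum.swap[of "\<lambda>v u. if strong v u then 1 else 0 :: nat" V V] graph(1)
    by (simp add: sum.If_cases Int_def)
  finally have "(\<Sum>v\<in>V. ?b v) \<le> (\<Sum>w\<in>V. card {v \<in> V. strong v w})" .
  moreover have "(\<Sum>w\<in>V. card {v \<in> V. strong v w} + 19) \<le> (\<Sum>w\<in>V. 4 * ?d w + ?b w)"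
    using strong_in by (intro sum_mono)
  then have "(\<Sum>w\<in>V. card {v \<in> V. strong v w}) + 19 * card V \<le> 4 * (\<Sum>w\<in>V. ?d w) + (\<Sum>w\<in>V. ?b w)"
    by (simp only: sum.distrib sum_distrib_left sum_constant mult.commute of_nat_id)
  ultimately have "19 * card V \<le> 4 * (\<Sum>w\<in>V. ?d w)" by linarith
  then show False using sum_degrees[OF simple] few_edges by simp
qed

end

theorem theorem2:
  fixes V :: "'a set" and E :: "'a set set"
  assumes "simple_graph V E"
    and "card V \<ge> 4"
    and "real (card E) < (19 * real (card V) - 28) / 8"
  shows "\<exists>M. forest_cut V E M"
proof -
  have "real (8 * card E + 28) < real (19 * card V)" using assms(3) by (simp add: field_simps)
  then have "8 * card E + 28 < 19 * card V" by (simp only: of_nat_less_iff)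
  with assms(1,2) have "\<exists>M B. forest_sep V E M B"
  \<comment> \<open>The induction hypothesis provides the assumption \<open>minimal\<close> of the
    locale.\<close>
  proof (induction "card V" arbitrary: V E rule: less_induct)
    case less
    show ?case
    proof (rule ccontr)
      assume "\<not> ?thesis"
      then interpret minimal_counterexample V E
      proof unfold_locales
        show "simple_graph V E" "4 \<le> card V" "8 * card E + 28 < 19 * card V" by (fact less.prems)+
        show "\<not> forest_sep V E M B" for M B using \<open>\<not> (\<exists>M B. forest_sep V E M B)\<close> by blast
      next
        fix V' :: "'a set" and E'
        assume "simple_graph V' E'" "4 \<le> card V'" "card V' < card V" "8 * card E' + 28 < 19 * card V'"
        then show "\<exists>M B. forest_sep V' E' M B" using less.hyps by blast
      qed
      show False by (rule contradiction)
    qed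
  qed
  then show ?thesis by (simp add: forest_cut_iff_sep)
qed

end
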